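(* Consider the $\sqrt{T\overline T}$ flow of the BMS free scalar with seed Lagrangian $\mathcal L^{(0)}=(\partial_y\phi)^2$, on the region $\partial_y\phi\ne0$: let $\mathcal L^{[\lambda]}=\sum_{n\ge0}\frac{\lambda^n}{n!}\mathcal L^{(n)}$ be the formal power series in $\lambda$, with coefficients smooth functions of $(\partial_x\phi,\partial_y\phi)$, with $\mathcal L^{[0]}=\mathcal L^{(0)}$ and $$\partial_\lambda\mathcal L^{[\lambda]}=\sqrt{\tfrac12T^{A[\lambda]}_{\ B}T^{B[\lambda]}_{\ A}-\tfrac14\left(T^{A[\lambda]}_{\ A}\right)^2}.$$ Then $$\mathcal L^{[\lambda]}=e^{\lambda}\mathcal L^{(0)},\qquad T^{A[\lambda]}_{\ B}=e^{\lambda}T^{A(0)}_{\ B},$$ that is, $\mathcal L^{(n)}=\mathcal L^{(0)}$ and $T^{A(n)}_{\ B}=T^{A(0)}_{\ B}$ for all $n\ge0$.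
   Context: $\phi=\phi(x,y)$ is a real scalar field; $\partial_x\phi,\partial_y\phi$ are treated as independent commuting real variables. Indices $A,B\in\{x,y\}$, repeated indices are summed. The stress tensor is $T^{A[\lambda]}_{\ B}=\frac{\partial\mathcal L^{[\lambda]}}{\partial(\partial_A\phi)}\partial_B\phi-\delta^A_{\ B}\mathcal L^{[\lambda]}=\sum_{n\ge0}\frac{\lambda^n}{n!}T^{A(n)}_{\ B}$. At $\lambda=0$ the components are $T^{y(0)}_{\ y}=-T^{x(0)}_{\ x}=M=(\partial_y\phi)^2$, $T^{y(0)}_{\ x}=2\partial_y\phi\,\partial_x\phi$, $T^{x(0)}_{\ y}=0$. The quantity under the square root has $\lambda^0$-coefficient $M^2$, and the square root is the formal power series square root whose $\lambda^0$-coefficient is $\sqrt{M^2}=M$. *)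

theory Defs
  imports
    "HOL-Analysis.Analysis"
    "HOL-Computational_Algebra.Formal_Power_Series"
begin

text \<open>
  A vector \<open>v :: real^2\<close> is the gradient of the field, with index \<open>1\<close> for the direction \<open>x\<close>
  and index \<open>2\<close> for the direction \<open>y\<close>: \<open>v $ 1\<close> is the \<open>x\<close>-derivative and \<open>v $ 2\<close> the
  \<open>y\<close>-derivative of \<open>\<phi>\<close>. A formal power series in \<open>\<lambda>\<close> whose coefficients are functions of the
  gradient is a map \<open>L :: real^2 \<Rightarrow> real fps\<close>; all ring operations on such series are pointwise
  in \<open>v\<close>.
\<close>

definition partial :: "2 \<Rightarrow> (real^2 \<Rightarrow> real) \<Rightarrow> real^2 \<Rightarrow> real" where
  "partial A f v = frechet_derivative f (at v) (axis A 1)"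

text \<open>Meant for open sets \<open>U\<close>, as \<open>partial\<close> is a two-sided derivative.\<close>

fun C_k_on :: "nat \<Rightarrow> (real^2) set \<Rightarrow> (real^2 \<Rightarrow> real) \<Rightarrow> bool" where
  "C_k_on 0 U f \<longleftrightarrow> continuous_on U f"
| "C_k_on (Suc k) U f \<longleftrightarrow> f differentiable_on U \<and> (\<forall>A. C_k_on k U (partial A f))"

definition smooth_on :: "(real^2) set \<Rightarrow> (real^2 \<Rightarrow> real) \<Rightarrow> bool" where
  "smooth_on U f \<longleftrightarrow> (\<forall>k. C_k_on k U f)"

text \<open>\<open>F\<close> is the sum of \<open>\<lambda>^n / fact n * taylor_coeff n F\<close> over all \<open>n\<close>.\<close>

definition taylor_coeff :: "nat \<Rightarrow> real fps \<Rightarrow> real" where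
  "taylor_coeff n F = fact n * fps_nth F n"

text \<open>The derivative by the gradient component \<open>A\<close> is taken coefficientwise in \<open>\<lambda>\<close>.\<close>

definition fps_partial :: "2 \<Rightarrow> (real^2 \<Rightarrow> real fps) \<Rightarrow> real^2 \<Rightarrow> real fps" where
  "fps_partial A L v = Abs_fps (\<lambda>n. partial A (\<lambda>w. fps_nth (L w) n) v)"

text \<open>\<open>stress_tensor L A B\<close> has upper index \<open>A\<close> and lower index \<open>B\<close>.\<close>

definition stress_tensor :: "(real^2 \<Rightarrow> real fps) \<Rightarrow> 2 \<Rightarrow> 2 \<Rightarrow> real^2 \<Rightarrow> real fps" where
  "stress_tensor L A B v = fps_partial A L v * fps_const (vec_nth v B) - (if A = B then L v else 0)"

definition sqrt_TTbar_radicand :: "(real^2 \<Rightarrow> real fps) \<Rightarrow> real^2 \<Rightarrow> real fps" where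
  "sqrt_TTbar_radicand L v =
     fps_const (1/2) * (\<Sum>A\<in>UNIV. \<Sum>B\<in>UNIV. stress_tensor L A B v * stress_tensor L B A v)
     - fps_const (1/4) * (\<Sum>A\<in>UNIV. stress_tensor L A A v)^2"

text \<open>For a series with positive constant term \<open>c\<close>, this is its unique square root with constant
  term \<open>sqrt c\<close>, see \<open>fps_sqrt_unique\<close> below.\<close>

definition fps_sqrt :: "real fps \<Rightarrow> real fps" where
  "fps_sqrt F = fps_radical root 2 F"

definition sqrt_TTbar_flow ::
    "(real^2) set \<Rightarrow> (real^2 \<Rightarrow> real) \<Rightarrow> (real^2 \<Rightarrow> real fps) \<Rightarrow> bool" where
  "sqrt_TTbar_flow U L0 L \<longleftrightarrow>
     (\<forall>n. smooth_on U (\<lambda>v. taylor_coeff n (L v))) \<and>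
     (\<forall>v\<in>U. taylor_coeff 0 (L v) = L0 v) \<and>
     (\<forall>v\<in>U. fps_deriv (L v) = fps_sqrt (sqrt_TTbar_radicand L v))"

definition bms_seed :: "real^2 \<Rightarrow> real" where
  "bms_seed v = (vec_nth v 2)^2"

definition bms_region :: "(real^2) set" where
  "bms_region = {v. vec_nth v 2 \<noteq> 0}"

lemma fps_sqrt_unique:
  fixes F G :: "real fps"
  assumes "fps_nth F 0 > 0"
  shows "G = fps_sqrt F \<longleftrightarrow> G^2 = F \<and> fps_nth G 0 = sqrt (fps_nth F 0)"
proof -
  have k: "(root (Suc 1) (fps_nth F 0)) ^ Suc 1 = fps_nth F 0"
    using assms by (simp add: sqrt_def[symmetric] numeral_2_eq_2[symmetric])
  have pow: "fps_sqrt F ^ 2 = F"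
    using iffD1[OF power_radical[of F root 1] k] assms
    unfolding fps_sqrt_def by (simp add: numeral_2_eq_2)
  have nth0: "fps_nth (fps_sqrt F) 0 = sqrt (fps_nth F 0)"
    by (simp add: fps_sqrt_def sqrt_def)
  show ?thesis
  proof
    assume "G = fps_sqrt F"
    then show "G^2 = F \<and> fps_nth G 0 = sqrt (fps_nth F 0)"
      using pow nth0 by simp
  next
    assume G: "G^2 = F \<and> fps_nth G 0 = sqrt (fps_nth F 0)"
    then have "G = fps_sqrt F \<or> G = - fps_sqrt F"
      using pow by (metis power2_eq_iff)
    moreover have "G \<noteq> - fps_sqrt F"
    proof
      assume "G = - fps_sqrt F"
      then have "sqrt (fps_nth F 0) = - sqrt (fps_nth F 0)"
        using G nth0 by (metis fps_neg_nth)
      then show False using assms by simp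
    qed
    ultimately show "G = fps_sqrt F" by simp
  qed
qed

lemma partial_bms_seed: "partial A bms_seed v = (if A = 2 then 2 * vec_nth v 2 else 0)"
proof -
  have "(bms_seed has_derivative (\<lambda>h. 2 * vec_nth v 2 * vec_nth h 2)) (at v)"
    unfolding bms_seed_def[abs_def] by (auto intro!: derivative_eq_intros bounded_linear_imp_has_derivative)
  then have "frechet_derivative bms_seed (at v) = (\<lambda>h. 2 * vec_nth v 2 * vec_nth h 2)"
    using frechet_derivative_at by metis
  then show ?thesis by (simp add: partial_def axis_def)
qed

lemma stress_tensor_bms_seed:
  fixes v :: "real^2"
  defines "T \<equiv> \<lambda>A B. taylor_coeff 0 (stress_tensor (\<lambda>w. fps_const (bms_seed w)) A B v)"
  shows "T 2 2 = (vec_nth v 2)^2" and "T 1 1 = - ((vec_nth v 2)^2)"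
    and "T 2 1 = 2 * vec_nth v 2 * vec_nth v 1" and "T 1 2 = 0"
proof -
  have [simp]: "partial A (\<lambda>w. (vec_nth w 2)^2) v = (if A = 2 then 2 * vec_nth v 2 else 0)" for A
    using partial_bms_seed[of A v] by (simp add: bms_seed_def[abs_def])
  have ne: "(1::2) \<noteq> 2" by simp
  show "T 2 2 = (vec_nth v 2)^2" "T 1 1 = - ((vec_nth v 2)^2)"
    "T 2 1 = 2 * vec_nth v 2 * vec_nth v 1" "T 1 2 = 0"
    using ne unfolding T_def
    by (simp_all add: taylor_coeff_def stress_tensor_def fps_partial_def bms_seed_def)
      (simp_all add: power2_eq_square)
qed

end

theory Submission
  imports Defs
begin

text \<open>
  In two dimensions the radicand is a perfect square for every Lagrangian: it equals
  \<open>((\<partial>\<^sub>x\<phi> \<partial>L/\<partial>(\<partial>\<^sub>x\<phi>) + \<partial>\<^sub>y\<phi> \<partial>L/\<partial>(\<partial>\<^sub>y\<phi>)) / 2)\<^sup>2\<close>. For the seed the quantity in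
  parentheses has constant term \<open>2 (\<partial>\<^sub>y\<phi>)\<^sup>2 > 0\<close>, so the flow is the linear equation
  \<open>L' = E L / 2\<close> with the Euler operator \<open>E\<close> of the gradient. The seed is homogeneous of
  degree \<open>2\<close>, hence an eigenvector of \<open>E / 2\<close> for the eigenvalue \<open>1\<close>.
\<close>

text \<open>A flow is constrained only on \<open>bms_region\<close>, so its derivatives there must
  not see values outside. \<open>frechet_derivative\<close> is a choice from
  \<open>has_derivative\<close>, which is local: equal germs give equal values, even where no
  derivative exists.\<close>

lemma partial_cong_open:
  assumes "open U" "v \<in> U" "\<And>w. w \<in> U \<Longrightarrow> f w = g w"
  shows "partial A f v = partial A g v"
proof -
  have "(f has_derivative D) (at v) \<longleftrightarrow> (g has_derivative D) (at v)" for D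
    using assms has_derivative_transform_within_open[of f D v UNIV U g]
      has_derivative_transform_within_open[of g D v UNIV U f] by auto
  then show ?thesis
    by (simp add: partial_def frechet_derivative_def)
qed

lemma partial_cmult_nth: "partial A (\<lambda>v. c * v $ i) v = (if A = i then c else 0)"
proof -
  have "((\<lambda>v. c * v $ i) has_derivative (\<lambda>h. c * h $ i)) (at v)"
    by (intro has_derivative_mult_right bounded_linear_imp_has_derivative bounded_linear_vec_nth)
  then have "frechet_derivative (\<lambda>v. c * v $ i) (at v) = (\<lambda>h. c * h $ i)"
    using frechet_derivative_at by metis
  then show ?thesis by (auto simp: partial_def axis_def)
qed

lemma euler_bms_seed: "partial 1 bms_seed v * v $ 1 + partial 2 bms_seed v * v $ 2 = 2 * bms_seed v"
  by (simp add: partial_bms_seed bms_seed_def power2_eq_square)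

lemma differentiable_bms_seed: "bms_seed differentiable (at v within U)"
  unfolding bms_seed_def[abs_def]
  by (intro derivative_intros bounded_linear_imp_differentiable bounded_linear_vec_nth)

lemma partial_divide_bms_seed:
  "partial A (\<lambda>w. bms_seed w / c) v = partial A bms_seed v / c"
proof -
  have "(bms_seed has_derivative frechet_derivative bms_seed (at v)) (at v)"
    using differentiable_bms_seed frechet_derivative_works by blast
  then have "((\<lambda>w. bms_seed w / c) has_derivative (\<lambda>h. frechet_derivative bms_seed (at v) h / c)) (at v)"
    using has_derivative_mult_right[of bms_seed _ _ "1 / c"] by simp
  then have "frechet_derivative (\<lambda>w. bms_seed w / c) (at v) = (\<lambda>h. frechet_derivative bms_seed (at v) h / c)"
    using frechet_derivative_at by metis
  then show ?thesis by (simp add: partial_def)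
qed

lemma C_k_on_const: "C_k_on k U (\<lambda>v. c)"
proof (induction k arbitrary: c)
  case (Suc k)
  have "partial A (\<lambda>v. c) = (\<lambda>v. 0)" for A
    by (simp add: partial_def fun_eq_iff)
  with Suc show ?case by simp
qed simp

lemma C_k_on_cmult_nth: "C_k_on k U (\<lambda>v. c * v $ i)"
proof (cases k)
  case 0
  then show ?thesis by (auto intro!: continuous_intros)
next
  case (Suc m)
  have "partial A (\<lambda>v. c * v $ i) = (\<lambda>v. if A = i then c else 0)" for A
    by (simp add: partial_cmult_nth fun_eq_iff)
  moreover have "(\<lambda>v. c * v $ i) differentiable_on U"
    unfolding differentiable_on_def
    by (intro ballI derivative_intros bounded_linear_imp_differentiable bounded_linear_vec_nth)
  ultimately show ?thesis using Suc by (simp add: C_k_on_const)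
qed

lemma smooth_on_bms_seed: "smooth_on U bms_seed"
  unfolding smooth_on_def
proof
  fix k show "C_k_on k U bms_seed"
  proof (cases k)
    case 0
    then show ?thesis
      by (auto simp: differentiable_on_def differentiable_bms_seed intro!: differentiable_imp_continuous_on)
  next
    case (Suc m)
    \<comment> \<open>Written as a multiple of \<open>v $ 2\<close> for both directions, so that
      \<open>C_k_on_cmult_nth\<close> applies to either.\<close>
    have "partial A bms_seed = (\<lambda>v. (if A = 2 then 2 else 0) * v $ 2)" for A
      by (simp add: partial_bms_seed fun_eq_iff)
    then show ?thesis
      using Suc by (simp add: C_k_on_cmult_nth differentiable_on_def differentiable_bms_seed)
  qed
qed

lemma open_bms_region: "open bms_region"
  unfolding bms_region_def by (intro open_Collect_neq continuous_intros)

lemma taylor_coeff_exp_const [simp]: "taylor_coeff n (fps_exp 1 * fps_const c) = c"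
  by (simp add: taylor_coeff_def)

text \<open>The stress tensor is a rank-one matrix \<open>N\<close> minus \<open>L v\<close> times
  the identity. In dimension two the radicand is half the trace of the square of the traceless part,
  so the identity term drops out; since \<open>N\<close> has rank one,
  \<open>tr (N * N) = (tr N)^2\<close>, which leaves \<open>(tr N / 2)^2\<close>.\<close>

lemma sqrt_TTbar_radicand_eq_square:
  "sqrt_TTbar_radicand L v = (fps_const (1/2) * (\<Sum>A\<in>UNIV. fps_partial A L v * fps_const (v $ A)))\<^sup>2"
proof -
  define h where "h = fps_const (1/2 :: real)"
  \<comment> \<open>The only property of the constant that the polynomial identity below uses, as it
    is proved by commutative ring reasoning.\<close>
  have h: "2 * h = 1"
    by (simp add: h_def numeral_fps_const)
  have q: "fps_const (1/4 :: real) = h * h"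
    by (simp add: h_def)
  have "h * (((p * a - l) * (p * a - l) + p * b * (q * a)) + (q * a * (p * b) + (q * b - l) * (q * b - l)))
      - h * h * ((p * a - l) + (q * b - l))\<^sup>2 = (h * (p * a + q * b))\<^sup>2" for p q a b l :: "real fps"
    using h by algebra
  from this[of "fps_partial 1 L v" "fps_const (v $ 1)" "L v" "fps_const (v $ 2)" "fps_partial 2 L v"]
  show ?thesis
    by (simp add: sqrt_TTbar_radicand_def stress_tensor_def sum_2 q h_def[symmetric])
qed

text \<open>The sign of the root is decided at order zero: by homogeneity of the seed,
  \<open>?G\<close> has constant term \<open>bms_seed v\<close>, which is positive on the
  region.\<close>

lemma fps_sqrt_radicand_bms:
  assumes "\<And>w. w \<in> bms_region \<Longrightarrow> fps_nth (L w) 0 = bms_seed w" "v \<in> bms_region"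
  shows "fps_sqrt (sqrt_TTbar_radicand L v)
    = fps_const (1/2) * (\<Sum>A\<in>UNIV. fps_partial A L v * fps_const (v $ A))" (is "_ = ?G")
proof -
  have "partial A (\<lambda>w. fps_nth (L w) 0) v = partial A bms_seed v" for A
    by (rule partial_cong_open[OF open_bms_region assms(2,1)])
  then have G0: "fps_nth ?G 0 = bms_seed v"
    by (simp add: fps_partial_def sum_2 partial_bms_seed bms_seed_def power2_eq_square)
  have pos: "bms_seed v > 0"
    using assms(2) by (simp add: bms_seed_def bms_region_def)
  have R0: "fps_nth (?G\<^sup>2) 0 = (bms_seed v)\<^sup>2"
    using G0 by (simp add: power2_eq_square)
  have "?G = fps_sqrt (?G\<^sup>2)"
    using fps_sqrt_unique[of "?G\<^sup>2" ?G] R0 G0 pos by simp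
  then show ?thesis
    by (simp add: sqrt_TTbar_radicand_eq_square)
qed

text \<open>The linear flow determines coefficient \<open>Suc n\<close> from the gradient of
  coefficient \<open>n\<close>. The induction keeps \<open>v\<close> arbitrary, because this
  gradient needs the previous coefficient near \<open>v\<close>.\<close>

lemma sqrt_TTbar_flow_bms_coeff:
  assumes "sqrt_TTbar_flow bms_region bms_seed L" "v \<in> bms_region"
  shows "fps_nth (L v) n = bms_seed v / fact n"
  using assms(2)
proof (induction n arbitrary: v)
  case 0
  then show ?case
    using assms(1) by (simp add: sqrt_TTbar_flow_def taylor_coeff_def)
next
  case (Suc n)
  have L0: "fps_nth (L w) 0 = bms_seed w" if "w \<in> bms_region" for w
    using assms(1) that by (simp add: sqrt_TTbar_flow_def taylor_coeff_def)
  have "partial A (\<lambda>w. fps_nth (L w) n) v = partial A (\<lambda>w. bms_seed w / fact n) v" for A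
    by (rule partial_cong_open[OF open_bms_region Suc.prems Suc.IH])
  \<comment> \<open>Half the Euler operator fixes \<open>bms_seed / fact n\<close>.\<close>
  then have "fps_nth (fps_sqrt (sqrt_TTbar_radicand L v)) n = bms_seed v / fact n"
    by (simp add: fps_sqrt_radicand_bms[OF L0 Suc.prems] fps_partial_def sum_2
        partial_divide_bms_seed euler_bms_seed flip: add_divide_distrib)
  moreover have "fps_deriv (L v) = fps_sqrt (sqrt_TTbar_radicand L v)"
    using assms(1) Suc.prems by (simp add: sqrt_TTbar_flow_def)
  ultimately have "real (Suc n) * fps_nth (L v) (Suc n) = bms_seed v / fact n"
    by (metis fps_deriv_nth Suc_eq_plus1)
  then show ?case
    by (simp add: field_simps del: of_nat_Suc)
qed

text \<open>Serves both the explicit solution and the stress tensor of an arbitrary flow, which is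
  known only on the region.\<close>

lemma fps_partial_exp_bms:
  assumes "\<And>w. w \<in> bms_region \<Longrightarrow> L w = fps_exp 1 * fps_const (bms_seed w)" "v \<in> bms_region"
  shows "fps_partial A L v = fps_exp 1 * fps_const (partial A bms_seed v)"
proof (rule fps_ext)
  fix n
  have "partial A (\<lambda>w. fps_nth (L w) n) v = partial A (\<lambda>w. bms_seed w / fact n) v"
    by (rule partial_cong_open[OF open_bms_region assms(2)]) (simp add: assms(1))
  then show "fps_nth (fps_partial A L v) n = fps_nth (fps_exp 1 * fps_const (partial A bms_seed v)) n"
    by (simp add: fps_partial_def partial_divide_bms_seed)
qed

text \<open>Existence, so that the uniqueness claim is not vacuous: \<open>fps_deriv\<close> and
  half the Euler operator both fix this series.\<close>

lemma sqrt_TTbar_flow_exp_bms: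
  "sqrt_TTbar_flow bms_region bms_seed (\<lambda>v. fps_exp 1 * fps_const (bms_seed v))"
proof -
  let ?L = "\<lambda>v. fps_exp (1::real) * fps_const (bms_seed v)"
  have "fps_deriv (?L v) = fps_sqrt (sqrt_TTbar_radicand ?L v)" if "v \<in> bms_region" for v
  proof -
    have "fps_sqrt (sqrt_TTbar_radicand ?L v)
        = fps_const (1/2) * (\<Sum>A\<in>UNIV. fps_partial A ?L v * fps_const (v $ A))"
      by (rule fps_sqrt_radicand_bms) (simp_all add: that)
    also have "\<dots> = ?L v"
      by (rule fps_ext) (simp add: fps_partial_exp_bms[OF refl that] sum_2 euler_bms_seed
          flip: add_divide_distrib)
    finally show ?thesis by simp
  qed
  then show ?thesis
    unfolding sqrt_TTbar_flow_def taylor_coeff_exp_const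
    using smooth_on_bms_seed by blast
qed

theorem mainTheorem5:
  "(\<exists>L. sqrt_TTbar_flow bms_region bms_seed L) \<and>
   (\<forall>L. sqrt_TTbar_flow bms_region bms_seed L \<longrightarrow>
      (\<forall>v\<in>bms_region.
         L v = fps_exp 1 * fps_const (bms_seed v) \<and>
         (\<forall>n. taylor_coeff n (L v) = bms_seed v) \<and>
         (\<forall>A B. stress_tensor L A B v
                  = fps_exp 1 * fps_const (taylor_coeff 0 (stress_tensor L A B v)) \<and>
                (\<forall>n. taylor_coeff n (stress_tensor L A B v)
                       = taylor_coeff 0 (stress_tensor L A B v)))))"
proof (intro conjI allI impI ballI)
  show "\<exists>L. sqrt_TTbar_flow bms_region bms_seed L"
    using sqrt_TTbar_flow_exp_bms by blast
next
  fix L v A B n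
  assume flow: "sqrt_TTbar_flow bms_region bms_seed L" and v: "v \<in> bms_region"
  have L: "L w = fps_exp 1 * fps_const (bms_seed w)" if "w \<in> bms_region" for w
    by (rule fps_ext) (simp add: sqrt_TTbar_flow_bms_coeff[OF flow that])
  show "L v = fps_exp 1 * fps_const (bms_seed v)" "taylor_coeff n (L v) = bms_seed v"
    using L[OF v] by simp_all
  \<comment> \<open>The stress tensor is linear in the Lagrangian, and the exponential does not
    depend on the gradient, so it factors out.\<close>
  have T: "stress_tensor L A B v = fps_exp 1 *
      fps_const (partial A bms_seed v * v $ B - (if A = B then bms_seed v else 0))"
    by (rule fps_ext)
      (simp add: stress_tensor_def fps_partial_exp_bms[OF L v] L[OF v] diff_divide_distrib)
  show "stress_tensor L A B v = fps_exp 1 * fps_const (taylor_coeff 0 (stress_tensor L A B v))"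
    "taylor_coeff n (stress_tensor L A B v) = taylor_coeff 0 (stress_tensor L A B v)"
    unfolding T taylor_coeff_exp_const by simp_all
qed

end
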